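(* Let $X$ be a nonzero separable real Banach space with the Daugavet property. Then $X$ contains a closed subspace $Z$ which is (linearly) isomorphic to $\ell^1$ and which is not poor in $X$.
   Context: Scalars are real. A normed space $X$ has the Daugavet property if $\|\mathrm{Id}+T\| = 1+\|T\|$ for every rank-one bounded linear operator $T\colon X\to X$. Poor subspace: let $X$ be a Banach space with the Daugavet property. A closed subspace $Z\subset X$ is said to be poor (in $X$) if the quotient space $X/\tilde Z$ has the Daugavet property for every closed subspace $\tilde Z\subset Z$. *)

theory Defs
  imports "HOL-Analysis.Analysis"
begin

text \<open>
  Quotients \<open>X/W\<close> by a closed subspace \<open>W\<close>, the sequence space \<open>\<ell>\<^sup>1\<close> and closed subspaces
  of \<open>X\<close> have to be treated as normed spaces in their own right, although they are not types.
  They are represented by a carrier together with their operations and norm, and the notions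
  below (linear operators, operator norm, Daugavet property, isomorphism) are relative to such
  a structure.  Operators are HOL functions of which only the values on the carrier matter.
\<close>

record 'v nspace =
  carr :: "'v set"
  nzero :: 'v
  nadd :: "'v \<Rightarrow> 'v \<Rightarrow> 'v"
  nscale :: "real \<Rightarrow> 'v \<Rightarrow> 'v"
  nnorm :: "'v \<Rightarrow> real"

definition is_normed_space :: "'v nspace \<Rightarrow> bool" where
  "is_normed_space N \<longleftrightarrow>
     nzero N \<in> carr N \<and>
     (\<forall>x\<in>carr N. \<forall>y\<in>carr N. nadd N x y \<in> carr N \<and> nadd N x y = nadd N y x) \<and>
     (\<forall>x\<in>carr N. \<forall>y\<in>carr N. \<forall>z\<in>carr N. nadd N (nadd N x y) z = nadd N x (nadd N y z)) \<and>
     (\<forall>x\<in>carr N. nadd N (nzero N) x = x \<and> nadd N x (nscale N (-1) x) = nzero N) \<and>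
     (\<forall>c. \<forall>x\<in>carr N. nscale N c x \<in> carr N) \<and>
     (\<forall>c d. \<forall>x\<in>carr N. nscale N (c + d) x = nadd N (nscale N c x) (nscale N d x)) \<and>
     (\<forall>c. \<forall>x\<in>carr N. \<forall>y\<in>carr N.
        nscale N c (nadd N x y) = nadd N (nscale N c x) (nscale N c y)) \<and>
     (\<forall>c d. \<forall>x\<in>carr N. nscale N c (nscale N d x) = nscale N (c * d) x) \<and>
     (\<forall>x\<in>carr N. nscale N 1 x = x) \<and>
     (\<forall>x\<in>carr N. 0 \<le> nnorm N x \<and> (nnorm N x = 0 \<longleftrightarrow> x = nzero N)) \<and>
     (\<forall>c. \<forall>x\<in>carr N. nnorm N (nscale N c x) = \<bar>c\<bar> * nnorm N x) \<and>
     (\<forall>x\<in>carr N. \<forall>y\<in>carr N. nnorm N (nadd N x y) \<le> nnorm N x + nnorm N y)"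

definition linear_op :: "'v nspace \<Rightarrow> 'w nspace \<Rightarrow> ('v \<Rightarrow> 'w) \<Rightarrow> bool" where
  "linear_op M N T \<longleftrightarrow>
     (\<forall>x\<in>carr M. T x \<in> carr N) \<and>
     (\<forall>x\<in>carr M. \<forall>y\<in>carr M. T (nadd M x y) = nadd N (T x) (T y)) \<and>
     (\<forall>c. \<forall>x\<in>carr M. T (nscale M c x) = nscale N c (T x))"

definition bounded_linear_op :: "'v nspace \<Rightarrow> 'w nspace \<Rightarrow> ('v \<Rightarrow> 'w) \<Rightarrow> bool" where
  "bounded_linear_op M N T \<longleftrightarrow>
     linear_op M N T \<and> (\<exists>B. \<forall>x\<in>carr M. nnorm N (T x) \<le> B * nnorm M x)"

definition rank_one_op :: "'v nspace \<Rightarrow> 'w nspace \<Rightarrow> ('v \<Rightarrow> 'w) \<Rightarrow> bool" where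
  "rank_one_op M N T \<longleftrightarrow>
     (\<exists>e\<in>carr N. e \<noteq> nzero N \<and> T ` carr M = range (\<lambda>c. nscale N c e))"

definition op_norm :: "'v nspace \<Rightarrow> 'w nspace \<Rightarrow> ('v \<Rightarrow> 'w) \<Rightarrow> real" where
  "op_norm M N T = (SUP x\<in>{x \<in> carr M. nnorm M x \<le> 1}. nnorm N (T x))"

definition daugavet_property :: "'v nspace \<Rightarrow> bool" where
  "daugavet_property N \<longleftrightarrow>
     (\<forall>T. bounded_linear_op N N T \<and> rank_one_op N N T \<longrightarrow>
        op_norm N N (\<lambda>x. nadd N x (T x)) = 1 + op_norm N N T)"

definition isomorphic_nspaces :: "'v nspace \<Rightarrow> 'w nspace \<Rightarrow> bool" where
  "isomorphic_nspaces M N \<longleftrightarrow>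
     (\<exists>T S. bounded_linear_op M N T \<and> bounded_linear_op N M S \<and>
        (\<forall>x\<in>carr M. S (T x) = x) \<and> (\<forall>y\<in>carr N. T (S y) = y))"

definition subspace_nspace :: "'a::real_normed_vector set \<Rightarrow> 'a nspace" where
  "subspace_nspace Z =
     \<lparr>carr = Z, nzero = 0, nadd = (+), nscale = scaleR, nnorm = norm\<rparr>"

abbreviation whole_nspace :: "'a::real_normed_vector nspace" where
  "whole_nspace \<equiv> subspace_nspace UNIV"

definition coset :: "'a::real_normed_vector set \<Rightarrow> 'a \<Rightarrow> 'a set" where
  "coset W x = {x + w |w. w \<in> W}"

text \<open>
  In the scalar multiple of a coset the summand from \<open>W\<close> only matters for \<open>c = 0\<close>, where the
  result has to be \<open>W\<close>.  The norm of a coset is the distance of a representative to \<open>W\<close>.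
\<close>

definition quotient_nspace :: "'a::real_normed_vector set \<Rightarrow> 'a set nspace" where
  "quotient_nspace W =
     \<lparr>carr = range (coset W),
      nzero = W,
      nadd = (\<lambda>A B. {a + b |a b. a \<in> A \<and> b \<in> B}),
      nscale = (\<lambda>c A. {c *\<^sub>R a + w |a w. a \<in> A \<and> w \<in> W}),
      nnorm = (\<lambda>A. INF a\<in>A. norm a)\<rparr>"

definition poor_subspace :: "'a::real_normed_vector set \<Rightarrow> bool" where
  "poor_subspace Z \<longleftrightarrow>
     (\<forall>W. subspace W \<and> closed W \<and> W \<subseteq> Z \<longrightarrow> daugavet_property (quotient_nspace W))"

definition ell1_nspace :: "(nat \<Rightarrow> real) nspace" where
  "ell1_nspace =
     \<lparr>carr = {x. summable (\<lambda>n. \<bar>x n\<bar>)},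
      nzero = (\<lambda>n. 0),
      nadd = (\<lambda>x y n. x n + y n),
      nscale = (\<lambda>c x n. c * x n),
      nnorm = (\<lambda>x. \<Sum>n. \<bar>x n\<bar>)\<rparr>"


subsection \<open>Consistency with the library\<close>

lemma subspace_nspace_simps [simp]:
  "carr (subspace_nspace Z) = Z" "nzero (subspace_nspace Z) = 0"
  "nadd (subspace_nspace Z) = (+)" "nscale (subspace_nspace Z) = scaleR"
  "nnorm (subspace_nspace Z) = norm"
  by (simp_all add: subspace_nspace_def)

lemma bounded_linear_op_whole_iff:
  "bounded_linear_op whole_nspace whole_nspace T \<longleftrightarrow> bounded_linear T"
proof
  assume "bounded_linear_op whole_nspace whole_nspace T"
  then show "bounded_linear T"
    unfolding bounded_linear_op_def linear_op_def
    by simp (metis bounded_linear_intro mult.commute)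
next
  assume T: "bounded_linear T"
  then have "linear T" by (rule bounded_linear.linear)
  with bounded_linear.bounded[OF T]
  show "bounded_linear_op whole_nspace whole_nspace T"
    unfolding bounded_linear_op_def linear_op_def
    by (auto simp: linear_add linear_scale mult.commute)
qed

lemma op_norm_whole_eq_onorm:
  assumes "bounded_linear T"
  shows "op_norm whole_nspace whole_nspace T = onorm T"
proof -
  have le: "norm (T x) \<le> onorm T" if "norm x \<le> 1" for x
  proof -
    have "norm (T x) \<le> onorm T * norm x" using assms by (rule onorm)
    also have "\<dots> \<le> onorm T"
      using that onorm_pos_le[OF assms] by (simp add: mult_left_le)
    finally show ?thesis .
  qed
  define S where "S = (SUP x\<in>{x. norm x \<le> 1}. norm (T x))"
  have bdd: "bdd_above ((\<lambda>x. norm (T x)) ` {x. norm x \<le> 1})"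
    using le by (auto intro!: bdd_aboveI)
  have "S \<le> onorm T"
    unfolding S_def by (rule cSUP_least) (auto intro: le exI[of _ 0])
  moreover have "onorm T \<le> S"
  proof (rule onorm_bound)
    show "0 \<le> S"
      unfolding S_def by (rule cSUP_upper2[OF bdd, of 0]) simp_all
    fix x show "norm (T x) \<le> S * norm x"
    proof (cases "x = 0")
      case True then show ?thesis
        using linear_0[OF bounded_linear.linear[OF assms]] by simp
    next
      case False
      have "norm (T (x /\<^sub>R norm x)) \<le> S"
        unfolding S_def by (rule cSUP_upper[OF _ bdd]) (use False in simp)
      with False show ?thesis
        using linear_scale[OF bounded_linear.linear[OF assms]]
        by (simp add: field_simps)
    qed
  qed
  ultimately show ?thesis by (simp add: op_norm_def S_def)
qed

lemma rank_one_op_whole_iff: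
  assumes "linear T"
  shows "rank_one_op whole_nspace whole_nspace T \<longleftrightarrow> dim (range T) = 1"
proof
  assume "rank_one_op whole_nspace whole_nspace T"
  then obtain e where e: "e \<noteq> 0" "range T = span {e}"
    by (auto simp: rank_one_op_def span_singleton)
  then show "dim (range T) = 1" by (simp add: dim_eq_card_independent)
next
  assume d: "dim (range T) = 1"
  obtain B where B: "B \<subseteq> range T" "independent B" "range T \<subseteq> span B" "card B = dim (range T)"
    using basis_exists by blast
  then obtain e where e: "B = {e}" using d by (metis card_1_singletonE)
  have "subspace (range T)"
    using assms linear_subspace_image subspace_UNIV by blast
  then have "range T = span {e}"
    using B e span_minimal by blast
  moreover have "e \<noteq> 0" using B e dependent_zero by blast
  ultimately show "rank_one_op whole_nspace whole_nspace T"
    by (auto simp: rank_one_op_def span_singleton)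
qed

lemma daugavet_property_whole_iff:
  "daugavet_property (whole_nspace :: 'a::real_normed_vector nspace) \<longleftrightarrow>
     (\<forall>T :: 'a \<Rightarrow> 'a. bounded_linear T \<and> dim (range T) = 1 \<longrightarrow>
        onorm (\<lambda>x. x + T x) = 1 + onorm T)"
proof -
  have "bounded_linear (\<lambda>x. x + T x)" if "bounded_linear T" for T :: "'a \<Rightarrow> 'a"
    by (intro bounded_linear_add bounded_linear_ident that)
  then show ?thesis
    unfolding daugavet_property_def bounded_linear_op_whole_iff
    by (auto simp: op_norm_whole_eq_onorm rank_one_op_whole_iff bounded_linear.linear)
qed

lemma coset_eq_iff: "subspace W \<Longrightarrow> coset W x = coset W y \<longleftrightarrow> x - y \<in> W"
proof
  assume W: "subspace W" and "coset W x = coset W y"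
  moreover have "x \<in> coset W x" using subspace_0[OF W] by (force simp: coset_def)
  ultimately show "x - y \<in> W" by (auto simp: coset_def)
next
  assume W: "subspace W" and d: "x - y \<in> W"
  have "x + w = y + ((x - y) + w)" "y + w = x + (w - (x - y))" for w by simp_all
  then show "coset W x = coset W y"
    using subspace_add[OF W d] subspace_diff[OF W _ d] unfolding coset_def by blast
qed

lemma quotient_nspace_simps:
  assumes W: "subspace W"
  shows "carr (quotient_nspace W) = range (coset W)"
    and "nzero (quotient_nspace W) = coset W 0"
    and "nadd (quotient_nspace W) (coset W x) (coset W y) = coset W (x + y)"
    and "nscale (quotient_nspace W) c (coset W x) = coset W (c *\<^sub>R x)"
    and "nnorm (quotient_nspace W) (coset W x) = infdist x W"
proof -
  show "carr (quotient_nspace W) = range (coset W)" "nzero (quotient_nspace W) = coset W 0"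
    by (simp_all add: quotient_nspace_def coset_def)
  show "nadd (quotient_nspace W) (coset W x) (coset W y) = coset W (x + y)"
  proof -
    have "\<exists>a b. x + y + w = a + b \<and> (\<exists>v. a = x + v \<and> v \<in> W) \<and> (\<exists>v. b = y + v \<and> v \<in> W)"
      if "w \<in> W" for w
      by (rule exI[of _ "x + w"], rule exI[of _ "y + 0"])
        (use that subspace_0[OF W] in \<open>auto simp: algebra_simps\<close>)
    moreover have "\<exists>u. (x + v) + (y + w) = (x + y) + u \<and> u \<in> W" if "v \<in> W" "w \<in> W" for v w
      by (rule exI[of _ "v + w"]) (use that subspace_add[OF W] in \<open>auto simp: algebra_simps\<close>)
    ultimately show ?thesis
      unfolding quotient_nspace_def coset_def by fastforce
  qed
  show "nscale (quotient_nspace W) c (coset W x) = coset W (c *\<^sub>R x)"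
  proof -
    have "\<exists>a v. c *\<^sub>R x + w = c *\<^sub>R a + v \<and> (\<exists>v. a = x + v \<and> v \<in> W) \<and> v \<in> W"
      if "w \<in> W" for w
      by (rule exI[of _ "x + 0"], rule exI[of _ w]) (use that subspace_0[OF W] in auto)
    moreover have "\<exists>u. c *\<^sub>R (x + v) + w = c *\<^sub>R x + u \<and> u \<in> W" if "v \<in> W" "w \<in> W" for v w
      by (rule exI[of _ "c *\<^sub>R v + w"])
        (use that subspace_add[OF W] subspace_scale[OF W] in \<open>auto simp: algebra_simps\<close>)
    ultimately show ?thesis
      unfolding quotient_nspace_def coset_def by fastforce
  qed
  have "norm ` coset W x = dist x ` W"
  proof -
    have "norm (x + w) = dist x (- w)" "dist x w = norm (x + (- w))" for w
      by (simp_all add: dist_norm)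
    then show ?thesis
      using subspace_neg[OF W] unfolding coset_def by (fastforce simp: image_iff)
  qed
  moreover have "W \<noteq> {}" using subspace_0[OF W] by blast
  ultimately show "nnorm (quotient_nspace W) (coset W x) = infdist x W"
    by (simp add: quotient_nspace_def infdist_def)
qed

lemma infdist_subspace_scale:
  fixes W :: "'a::real_normed_vector set"
  assumes W: "subspace W"
  shows "infdist (c *\<^sub>R x) W = \<bar>c\<bar> * infdist x W"
proof (cases "c = 0")
  case True then show ?thesis using subspace_0[OF W] by simp
next
  case False
  have ne: "W \<noteq> {}" using subspace_0[OF W] by blast
  have le: "infdist (d *\<^sub>R y) W \<le> \<bar>d\<bar> * infdist y W" if "d \<noteq> 0" for d y
  proof -
    have "infdist (d *\<^sub>R y) W / \<bar>d\<bar> \<le> infdist y W"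
      unfolding infdist_notempty[OF ne, of y]
    proof (rule cINF_greatest[OF ne])
      fix w assume "w \<in> W"
      then have "infdist (d *\<^sub>R y) W \<le> dist (d *\<^sub>R y) (d *\<^sub>R w)"
        by (intro infdist_le subspace_scale[OF W])
      also have "\<dots> = \<bar>d\<bar> * dist y w"
        by (metis dist_norm norm_scaleR scaleR_diff_right)
      finally show "infdist (d *\<^sub>R y) W / \<bar>d\<bar> \<le> dist y w"
        using that by (simp add: field_simps)
    qed
    with that show ?thesis by (simp add: field_simps)
  qed
  have "infdist (inverse c *\<^sub>R (c *\<^sub>R x)) W \<le> \<bar>inverse c\<bar> * infdist (c *\<^sub>R x) W"
    using False by (intro le) simp
  then have "\<bar>c\<bar> * infdist x W \<le> infdist (c *\<^sub>R x) W"
    using False by (simp add: field_simps)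
  with le[OF False, of x] show ?thesis by simp
qed

lemma infdist_subspace_add:
  fixes W :: "'a::real_normed_vector set"
  assumes W: "subspace W"
  shows "infdist (x + y) W \<le> infdist x W + infdist y W"
proof -
  have ne: "W \<noteq> {}" using subspace_0[OF W] by blast
  have "infdist (x + y) W - infdist y W \<le> infdist x W"
    unfolding infdist_notempty[OF ne, of x]
  proof (rule cINF_greatest[OF ne])
    fix w assume w: "w \<in> W"
    have "infdist (x + y) W - dist x w \<le> infdist y W"
      unfolding infdist_notempty[OF ne, of y]
    proof (rule cINF_greatest[OF ne])
      fix v assume "v \<in> W"
      with w have "infdist (x + y) W \<le> dist (x + y) (w + v)"
        by (intro infdist_le subspace_add[OF W])
      also have "\<dots> \<le> dist x w + dist y v" using norm_triangle_ineq[of "x - w" "y - v"]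
        by (simp add: dist_norm algebra_simps)
      finally show "infdist (x + y) W - dist x w \<le> dist y v" by simp
    qed
    then show "infdist (x + y) W - infdist y W \<le> dist x w" by simp
  qed
  then show ?thesis by simp
qed

lemma is_normed_space_quotient:
  assumes W: "subspace W" "closed W"
  shows "is_normed_space (quotient_nspace W)"
proof -
  have "W \<noteq> {}" using subspace_0[OF W(1)] by blast
  then have "infdist x W = 0 \<longleftrightarrow> x \<in> W" for x
    using in_closed_iff_infdist_zero[OF W(2)] by blast
  then show ?thesis
    unfolding is_normed_space_def
    by (auto simp: quotient_nspace_simps[OF W(1)] coset_eq_iff[OF W(1)] infdist_nonneg
          infdist_subspace_scale[OF W(1)] infdist_subspace_add[OF W(1)] algebra_simps
          subspace_0[OF W(1)])
qed

lemma is_normed_space_subspace: "subspace Z \<Longrightarrow> is_normed_space (subspace_nspace Z)"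
  by (auto simp: is_normed_space_def algebra_simps norm_triangle_ineq
        intro: subspace_0 subspace_add subspace_scale subspace_neg)

lemma is_normed_space_ell1: "is_normed_space ell1_nspace"
proof -
  have add: "summable (\<lambda>n. \<bar>x n + y n\<bar>)"
    if "summable (\<lambda>n. \<bar>x n\<bar>)" "summable (\<lambda>n. \<bar>y n\<bar>)" for x y :: "nat \<Rightarrow> real"
    by (rule summable_comparison_test'[OF summable_add[OF that], of 0]) simp
  have "(\<Sum>n. \<bar>x n + y n\<bar>) \<le> (\<Sum>n. \<bar>x n\<bar>) + (\<Sum>n. \<bar>y n\<bar>)"
    if "summable (\<lambda>n. \<bar>x n\<bar>)" "summable (\<lambda>n. \<bar>y n\<bar>)" for x y :: "nat \<Rightarrow> real"
    unfolding suminf_add[OF that]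
    by (intro suminf_le add that summable_add) simp
  moreover have "summable (\<lambda>n. \<bar>c * x n\<bar>)" "(\<Sum>n. \<bar>c * x n\<bar>) = \<bar>c\<bar> * (\<Sum>n. \<bar>x n\<bar>)"
    if "summable (\<lambda>n. \<bar>x n\<bar>)" for c and x :: "nat \<Rightarrow> real"
    using summable_mult[OF that, of "\<bar>c\<bar>"] suminf_mult[OF that, of "\<bar>c\<bar>"]
    by (simp_all add: abs_mult)
  moreover have "0 \<le> (\<Sum>n. \<bar>x n\<bar>)" "(\<Sum>n. \<bar>x n\<bar>) = 0 \<longleftrightarrow> x = (\<lambda>n. 0)"
    if "summable (\<lambda>n. \<bar>x n\<bar>)" for x :: "nat \<Rightarrow> real"
    using suminf_nonneg[OF that] suminf_eq_zero_iff[OF that] by (simp_all add: fun_eq_iff)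
  ultimately show ?thesis
    unfolding is_normed_space_def ell1_nspace_def
    by (simp add: add) (simp add: fun_eq_iff algebra_simps)
qed

end

theory Submission
  imports Defs
begin

text \<open>
  Fix a functional \<open>f\<close> of norm one and a dense sequence \<open>y\<^sub>n\<close> in the (slightly enlarged) slice of
  points \<open>y\<close> with \<open>norm y < 21/20\<close> and \<open>f y > 9/10\<close>.  The Daugavet property supplies, in the slice
  \<open>f > 9/10\<close> of the unit ball, points that are nearly \<open>\<ell>\<^sup>1\<close>-orthogonal to any prescribed compact
  set (\<open>daugavet_slice_compact\<close>).  Hence points \<open>u\<^sub>n\<close> of that slice can be chosen inductively so that
  the vectors \<open>z\<^sub>n = u\<^sub>n + y\<^sub>n / 2\<close> satisfy a lower \<open>\<ell>\<^sup>1\<close>-estimate: the new summand \<open>u\<^sub>n\<close> adds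
  almost its full coefficient to the norm, of which \<open>y\<^sub>n / 2\<close> can destroy only about one half, however
  \<open>y\<^sub>n\<close> is related to the earlier vectors (\<open>daugavet_ell1_sequence\<close>).  So the closed span \<open>Z\<close> of
  the \<open>z\<^sub>n\<close> is isomorphic to \<open>\<ell>\<^sup>1\<close> (\<open>ell1_sequence_spans_closed_ell1\<close>).

  Let \<open>W\<close> be the kernel of \<open>f\<close> in \<open>Z\<close>, and \<open>x = - (2/3) z\<^sub>0\<close>.  As \<open>f\<close> vanishes on \<open>W\<close>, the
  class of \<open>x\<close> in \<open>X/W\<close> has norm at least \<open>\<bar>f x\<bar> \<ge> 9/10\<close>.  Because both \<open>u\<^sub>n\<close> and \<open>y\<^sub>n\<close> lie
  in slices of \<open>f\<close>, all values of \<open>f\<close> at the \<open>z\<^sub>n\<close> are close to \<open>3/2\<close>; so \<open>x + l z\<^sub>n \<in> W\<close> for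
  some \<open>l\<close> close to \<open>2/3\<close>, and modulo \<open>W\<close> the vector \<open>x + y\<^sub>n\<close> equals
  \<open>y\<^sub>n - l z\<^sub>n = (1 - l/2) y\<^sub>n - l u\<^sub>n\<close>, of norm at most about \<open>4/3\<close>.  By density, every point of
  the slice of the unit ball of \<open>X/W\<close> given by \<open>f\<close> stays at distance well below \<open>1 + norm [x]\<close>
  from \<open>- [x]\<close>, which is incompatible with the Daugavet equation for the rank-one operator
  \<open>[y] \<mapsto> f y [x]\<close> (\<open>quotient_not_daugavet\<close>).  The functionals needed along the way come from
  the Hahn-Banach theorem (\<open>norming_functional\<close>).
\<close>

section \<open>Norming functionals\<close>

text \<open>
  Requiring only an inequality for positive scalars makes the property easy to verify; applied to
  \<open>c\<close> and \<open>inverse c\<close> it gives full positive homogeneity.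
\<close>

definition sublinear :: "('a::real_vector \<Rightarrow> real) \<Rightarrow> bool" where
  "sublinear p \<longleftrightarrow> (\<forall>x y. p (x + y) \<le> p x + p y) \<and> (\<forall>c>0. \<forall>x. p (c *\<^sub>R x) \<le> c * p x)"

lemma sublinear_add: "sublinear p \<Longrightarrow> p (x + y) \<le> p x + p y"
  by (simp add: sublinear_def)

lemma sublinear_zero:
  assumes "sublinear p"
  shows "p 0 = 0"
proof -
  have "p (0 + 0) \<le> p 0 + p 0" "p ((1/2) *\<^sub>R 0) \<le> (1/2) * p 0"
    using assms unfolding sublinear_def by (blast, metis half_gt_zero zero_less_one)
  then show ?thesis by simp
qed

lemma sublinear_scale:
  assumes p: "sublinear p" and c: "0 \<le> c"
  shows "p (c *\<^sub>R x) = c * p x"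
proof (cases "c = 0")
  case True
  then show ?thesis by (simp add: sublinear_zero[OF p])
next
  case False
  with c have c: "0 < c" by simp
  have "p (inverse c *\<^sub>R (c *\<^sub>R x)) \<le> inverse c * p (c *\<^sub>R x)"
    using p c unfolding sublinear_def by (metis positive_imp_inverse_positive)
  then have "c * p x \<le> p (c *\<^sub>R x)"
    using c by (simp add: field_simps)
  moreover have "p (c *\<^sub>R x) \<le> c * p x"
    using p c by (simp add: sublinear_def)
  ultimately show ?thesis by simp
qed

lemma sublinear_ge_neg: "sublinear p \<Longrightarrow> - p (- x) \<le> p x"
  using sublinear_add[of p x "- x"] sublinear_zero[of p] by simp

text \<open>
  The largest sublinear minorant of \<open>p\<close> that has the value \<open>p z\<close> at \<open>z\<close> and is additive in the
  direction of \<open>z\<close>.  A minimal sublinear functional coincides with all its minorants of this kind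
  and is therefore additive in every direction.
\<close>

definition directional_lower :: "('a::real_vector \<Rightarrow> real) \<Rightarrow> 'a \<Rightarrow> 'a \<Rightarrow> real" where
  "directional_lower p z x = (INF t\<in>{0..}. p (x + t *\<^sub>R z) - t * p z)"

lemma directional_lower_le:
  assumes p: "sublinear p" and t: "0 \<le> t"
  shows "directional_lower p z x \<le> p (x + t *\<^sub>R z) - t * p z"
  unfolding directional_lower_def
proof (rule cINF_lower)
  have "- p (- x) \<le> p (x + s *\<^sub>R z) - s * p z" if "0 \<le> s" for s
    using sublinear_add[OF p, of "x + s *\<^sub>R z" "- x"] sublinear_scale[OF p that, of z] by simp
  then show "bdd_below ((\<lambda>t. p (x + t *\<^sub>R z) - t * p z) ` {0..})"
    by (auto intro!: bdd_belowI)
qed (use t in simp)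

lemma directional_lower_greatest:
  "(\<And>t. 0 \<le> t \<Longrightarrow> m \<le> p (x + t *\<^sub>R z) - t * p z) \<Longrightarrow> m \<le> directional_lower p z x"
  unfolding directional_lower_def by (rule cINF_greatest) auto

lemma sublinear_directional_lower:
  assumes p: "sublinear p"
  shows "sublinear (directional_lower p z)"
  unfolding sublinear_def
proof (intro conjI allI impI)
  fix x y
  let ?q = "directional_lower p z"
  have "?q (x + y) - ?q y \<le> p (x + s *\<^sub>R z) - s * p z" if s: "0 \<le> s" for s
  proof -
    have "?q (x + y) - (p (x + s *\<^sub>R z) - s * p z) \<le> ?q y"
    proof (rule directional_lower_greatest)
      fix t :: real assume t: "0 \<le> t"
      have "?q (x + y) \<le> p ((x + s *\<^sub>R z) + (y + t *\<^sub>R z)) - (s + t) * p z"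
        using directional_lower_le[OF p, of "s + t" z "x + y"] s t by (simp add: algebra_simps)
      then show "?q (x + y) - (p (x + s *\<^sub>R z) - s * p z) \<le> p (y + t *\<^sub>R z) - t * p z"
        using sublinear_add[OF p, of "x + s *\<^sub>R z" "y + t *\<^sub>R z"] by (simp add: algebra_simps)
    qed
    then show ?thesis by simp
  qed
  then have "?q (x + y) - ?q y \<le> ?q x" by (rule directional_lower_greatest)
  then show "?q (x + y) \<le> ?q x + ?q y" by simp
next
  fix c :: real and x assume c: "0 < c"
  let ?q = "directional_lower p z"
  have "?q (c *\<^sub>R x) / c \<le> ?q x"
  proof (rule directional_lower_greatest)
    fix t :: real assume t: "0 \<le> t"
    have "?q (c *\<^sub>R x) \<le> p (c *\<^sub>R (x + t *\<^sub>R z)) - (c * t) * p z"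
      using directional_lower_le[OF p, of "c * t" z "c *\<^sub>R x"] c t by (simp add: algebra_simps)
    then show "?q (c *\<^sub>R x) / c \<le> p (x + t *\<^sub>R z) - t * p z"
      using c sublinear_scale[OF p, of c "x + t *\<^sub>R z"]
      by (simp add: pos_divide_le_eq right_diff_distrib mult.commute mult.left_commute)
  qed
  then show "?q (c *\<^sub>R x) \<le> c * ?q x"
    using c by (simp add: field_simps)
qed

lemma minimal_sublinear_imp_linear:
  fixes p :: "'a::real_vector \<Rightarrow> real"
  assumes p: "sublinear p"
    and minimal: "\<And>q. sublinear q \<Longrightarrow> (\<And>x. q x \<le> p x) \<Longrightarrow> q = p"
  shows "linear p"
proof -
  have "directional_lower p z = p" for z
    using minimal[OF sublinear_directional_lower[OF p]] directional_lower_le[OF p, of 0 z] by simp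
  then have add: "p (x + z) = p x + p z" for x z
    using directional_lower_le[OF p, of 1 z x] sublinear_add[OF p, of x z] by simp
  then have neg: "p (- x) = - p x" for x
    using add[of x "- x"] sublinear_zero[OF p] by simp
  have "p (c *\<^sub>R x) = c * p x" for c x
  proof (cases "0 \<le> c")
    case True then show ?thesis by (rule sublinear_scale[OF p])
  next
    case False
    then show ?thesis
      using sublinear_scale[OF p, of "- c" x] neg[of "c *\<^sub>R x"] by simp
  qed
  with add show ?thesis by (simp add: linear_iff)
qed

text \<open>
  Zorn's lemma yields a minimal sublinear functional below \<open>p\<close>: the pointwise infimum of a chain is
  finite because every member \<open>q\<close> satisfies \<open>q x \<ge> - q (- x) \<ge> - p (- x)\<close>, and it is subadditive
  because two members of the chain can be replaced by the smaller one.
\<close>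

lemma sublinear_dominates_linear:
  fixes p :: "'a::real_vector \<Rightarrow> real"
  assumes p: "sublinear p"
  obtains f where "linear f" "\<And>x. f x \<le> p x"
proof -
  define A where "A = {q. sublinear q \<and> (\<forall>x. q x \<le> p x)}"
  define below :: "('a \<Rightarrow> real) \<Rightarrow> ('a \<Rightarrow> real) \<Rightarrow> bool" where "below = (\<lambda>q r. r \<le> q)"
  have "\<exists>m\<in>A. \<forall>q\<in>A. below m q \<longrightarrow> q = m"
  proof (rule predicate_Zorn)
    show "partial_order_on A (relation_of below A)"
      by (rule partial_order_on_relation_ofI) (auto simp: below_def)
  next
    fix C assume "C \<in> Chains (relation_of below A)"
    then have CA: "C \<subseteq> A" and chain: "\<And>q r. q \<in> C \<Longrightarrow> r \<in> C \<Longrightarrow> q \<le> r \<or> r \<le> q"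
      by (auto simp: Chains_def relation_of_def below_def)
    show "\<exists>u\<in>A. \<forall>a\<in>C. below a u"
    proof (cases "C = {}")
      case True
      then show ?thesis using p by (auto simp: A_def)
    next
      case False
      define u where "u = (\<lambda>x. INF q\<in>C. q x)"
      have "- p (- x) \<le> q x" if "q \<in> C" for q x
        using that CA sublinear_ge_neg[of q x] by (force simp: A_def dest: spec[of _ "- x"])
      then have u_le: "u x \<le> q x" if "q \<in> C" for q x
        unfolding u_def using that by (intro cINF_lower) (auto intro!: bdd_belowI)
      have u_greatest: "m \<le> u x" if "\<And>q. q \<in> C \<Longrightarrow> m \<le> q x" for m x
        unfolding u_def using False that by (intro cINF_greatest) auto
      have subl: "sublinear q" if "q \<in> C" for q using that CA by (auto simp: A_def)
      have "sublinear u"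
        unfolding sublinear_def
      proof (intro conjI allI impI)
        fix x y
        have *: "u (x + y) \<le> q x + r y" if q: "q \<in> C" and r: "r \<in> C" for q r
        proof -
          obtain s where s: "s \<in> C" "s \<le> q" "s \<le> r" using chain[OF q r] q r by blast
          have "u (x + y) \<le> s x + s y"
            using u_le[OF s(1), of "x + y"] sublinear_add[OF subl[OF s(1)], of x y] by simp
          then show ?thesis using s(2,3)[THEN le_funD] by (meson add_mono order_trans)
        qed
        have "u (x + y) - u y \<le> q x" if "q \<in> C" for q
        proof -
          have "u (x + y) - q x \<le> u y"
            using *[OF that] by (intro u_greatest) (simp add: algebra_simps)
          then show ?thesis by simp
        qed
        then have "u (x + y) - u y \<le> u x" by (rule u_greatest)
        then show "u (x + y) \<le> u x + u y" by simp
      next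
        fix c :: real and x assume c: "0 < c"
        have "u (c *\<^sub>R x) / c \<le> u x"
        proof (rule u_greatest)
          fix q assume q: "q \<in> C"
          show "u (c *\<^sub>R x) / c \<le> q x"
            using u_le[OF q, of "c *\<^sub>R x"] sublinear_scale[OF subl[OF q], of c x] c
            by (simp add: field_simps)
        qed
        then show "u (c *\<^sub>R x) \<le> c * u x" using c by (simp add: field_simps)
      qed
      moreover obtain q where "q \<in> C" using False by blast
      then have "u x \<le> p x" for x using u_le[of q x] CA by (auto simp: A_def intro: order_trans)
      ultimately show ?thesis using u_le by (auto simp: A_def below_def le_fun_def)
    qed
  qed
  then obtain m where m: "m \<in> A" and min: "\<And>q. q \<in> A \<Longrightarrow> q \<le> m \<Longrightarrow> q = m"
    by (auto simp: below_def)
  have "linear m"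
  proof (rule minimal_sublinear_imp_linear)
    show "sublinear m" using m by (simp add: A_def)
    show "q = m" if "sublinear q" "\<And>x. q x \<le> m x" for q
      using min[of q] m that by (auto simp: A_def le_fun_def intro: order_trans)
  qed
  then show thesis using m that by (auto simp: A_def)
qed

text \<open>
  Starting from the directional minorant of the norm at \<open>z\<close> instead of the norm itself forces
  \<open>f (- z) \<le> - norm z\<close>.
\<close>

lemma norming_functional:
  fixes z :: "'a::real_normed_vector"
  obtains f :: "'a \<Rightarrow> real" where "linear f" "\<And>x. \<bar>f x\<bar> \<le> norm x" "f z = norm z"
proof -
  have n: "sublinear (norm :: 'a \<Rightarrow> real)"
    by (simp add: sublinear_def norm_triangle_ineq)
  obtain f where f: "linear f" "\<And>x. f x \<le> directional_lower norm z x"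
    using sublinear_dominates_linear[OF sublinear_directional_lower[OF n]] by blast
  have le: "f x \<le> norm x" for x
    using f(2)[of x] directional_lower_le[OF n, of 0 z x] by simp
  have "\<bar>f x\<bar> \<le> norm x" for x
    using le[of x] le[of "- x"] by (simp add: linear_neg[OF f(1)] abs_le_iff)
  moreover have "f (- z) \<le> - norm z"
    using f(2)[of "- z"] directional_lower_le[OF n, of 1 z "- z"] by simp
  then have "f z = norm z"
    using le[of z] by (simp add: linear_neg[OF f(1)])
  ultimately show thesis using that f(1) by blast
qed

section \<open>Slices of the unit ball under the Daugavet property\<close>

lemma less_onorm_witness:
  assumes T: "linear T" and c: "0 \<le> c" "c < onorm T"
  obtains x where "norm x \<le> 1" "c < norm (T x)"
proof -
  have "\<exists>x. c * norm x < norm (T x)"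
    using onorm_bound[OF c(1), of T] c(2) by (meson not_le)
  then obtain x where x: "c * norm x < norm (T x)" by blast
  then have "x \<noteq> 0" using linear_0[OF T] by auto
  with x have "c < norm (T (inverse (norm x) *\<^sub>R x))"
    by (simp add: linear_scale[OF T] field_simps)
  moreover have "norm (inverse (norm x) *\<^sub>R x) \<le> 1" using \<open>x \<noteq> 0\<close> by simp
  ultimately show thesis using that by blast
qed

lemma norm_one_functional_witness:
  fixes f :: "'a::real_normed_vector \<Rightarrow> real"
  assumes f: "bounded_linear f" "onorm f = 1" and \<alpha>: "0 < \<alpha>"
  obtains u where "norm u \<le> 1" "1 - \<alpha> < f u"
proof -
  have lin: "linear f" using f(1) by (rule bounded_linear.linear)
  obtain u where u: "norm u \<le> 1" "max 0 (1 - \<alpha>) < \<bar>f u\<bar>"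
    using less_onorm_witness[OF lin, of "max 0 (1 - \<alpha>)"] f(2) \<alpha> by auto
  show thesis
  proof (cases "0 \<le> f u")
    case True then show ?thesis using that[of u] u by simp
  next
    case False then show ?thesis using that[of "- u"] u by (simp add: linear_neg[OF lin])
  qed
qed

text \<open>
  If \<open>w\<close> in the unit ball nearly attains the norm \<open>1 + norm v\<close> of \<open>Id + f \<otimes> v\<close>, then up to sign
  \<open>f w\<close> must be close to one, so that \<open>w + f w v\<close> is close to \<open>w + v\<close>.
\<close>

lemma daugavet_slice_element:
  fixes f :: "'a::real_normed_vector \<Rightarrow> real"
  assumes D: "daugavet_property (whole_nspace :: 'a nspace)"
    and f: "bounded_linear f" "onorm f = 1" and \<alpha>: "0 < \<alpha>" and \<delta>: "0 < \<delta>"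
  obtains u where "norm u \<le> 1" "1 - \<alpha> < f u" "norm v + 1 - \<delta> \<le> norm (v + u)"
proof (cases "v = 0")
  case True
  obtain u where u: "norm u \<le> 1" "1 - min \<alpha> \<delta> < f u"
    using norm_one_functional_witness[OF f, of "min \<alpha> \<delta>"] \<alpha> \<delta> by auto
  moreover have "\<bar>f u\<bar> \<le> norm u" using onorm[OF f(1), of u] f(2) by simp
  ultimately show thesis using that[of u] True by simp
next
  case False
  have lin: "linear f" using f(1) by (rule bounded_linear.linear)
  have bound: "\<bar>f x\<bar> \<le> norm x" for x using onorm[OF f(1), of x] f(2) by simp
  define T where "T = (\<lambda>x. f x *\<^sub>R v)"
  have T: "bounded_linear T"
    unfolding T_def by (rule bounded_linear_scaleR_const[OF f(1)])
  obtain e where e: "f e \<noteq> 0"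
    using norm_one_functional_witness[OF f, of 1] by (metis diff_self less_irrefl zero_less_one)
  have "range T = range (\<lambda>c. c *\<^sub>R v)"
  proof (intro equalityI subsetI)
    fix y assume "y \<in> range (\<lambda>c. c *\<^sub>R v)"
    then obtain c where "y = T ((c / f e) *\<^sub>R e)"
      using e by (auto simp: T_def linear_scale[OF lin])
    then show "y \<in> range T" by simp
  qed (auto simp: T_def)
  then have "rank_one_op whole_nspace whole_nspace T"
    using False by (auto simp: rank_one_op_def)
  moreover have "onorm T = norm v"
    unfolding T_def using onorm_scaleR_left[OF f(1), of v] f(2) by simp
  moreover have IT: "bounded_linear (\<lambda>x. x + T x)"
    by (intro bounded_linear_add bounded_linear_ident T)
  moreover have "op_norm whole_nspace whole_nspace (\<lambda>x. x + T x)
      = 1 + op_norm whole_nspace whole_nspace T"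
    if "rank_one_op whole_nspace whole_nspace T"
    using D T that unfolding daugavet_property_def bounded_linear_op_whole_iff by simp
  ultimately have norm_IT: "onorm (\<lambda>x. x + T x) = 1 + norm v"
    using op_norm_whole_eq_onorm[OF IT] op_norm_whole_eq_onorm[OF T] by simp
  define \<eta> where "\<eta> = min (min (\<delta> / 2) (\<alpha> * norm v)) 1"
  have \<eta>: "0 < \<eta>" "\<eta> \<le> \<delta> / 2" "\<eta> \<le> \<alpha> * norm v" "\<eta> \<le> 1"
    using \<alpha> \<delta> False by (auto simp: \<eta>_def)
  obtain w where w: "norm w \<le> 1" "1 + norm v - \<eta> < norm (w + T w)"
  proof (rule less_onorm_witness[OF bounded_linear.linear[OF IT], of "1 + norm v - \<eta>"])
    show "0 \<le> 1 + norm v - \<eta>" using \<eta>(4) by (simp add: add_increasing2)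
    show "1 + norm v - \<eta> < onorm (\<lambda>x. x + T x)" using norm_IT \<eta>(1) by simp
  qed
  define u where "u = (if 0 \<le> f w then w else - w)"
  have fu: "f u \<ge> 0" by (auto simp: u_def linear_neg[OF lin])
  have u: "norm u \<le> 1" using w(1) by (auto simp: u_def)
  have "u + f u *\<^sub>R v = (if 0 \<le> f w then w + T w else - (w + T w))"
    by (simp add: u_def T_def linear_neg[OF lin])
  then have u2: "1 + norm v - \<eta> < norm (u + f u *\<^sub>R v)"
    using w(2) by (metis norm_minus_cancel)
  have fu1: "f u \<le> 1" using bound[of u] u by simp
  have "norm (u + f u *\<^sub>R v) \<le> 1 + f u * norm v"
    using norm_triangle_ineq[of u "f u *\<^sub>R v"] u fu by simp
  then have less: "(1 - f u) * norm v < \<eta>" using u2 by (simp add: algebra_simps)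
  then have "(1 - f u) * norm v < \<alpha> * norm v" using \<eta>(3) by simp
  then have "1 - \<alpha> < f u" using False by simp
  moreover have "norm v + 1 - \<delta> \<le> norm (v + u)"
  proof -
    have eq: "u + f u *\<^sub>R v = (v + u) - (1 - f u) *\<^sub>R v" by (simp add: algebra_simps)
    have "norm (u + f u *\<^sub>R v) \<le> norm (v + u) + norm ((1 - f u) *\<^sub>R v)"
      unfolding eq by (rule norm_triangle_ineq4)
    also have "norm ((1 - f u) *\<^sub>R v) < \<eta>" using less fu1 by simp
    finally show ?thesis using u2 \<eta>(2) by simp
  qed
  ultimately show thesis using that u by blast
qed

text \<open>
  A single good point \<open>e\<close> can be upgraded to a whole slice: let \<open>h\<close> be a norming functional of
  \<open>v + e\<close>.  Both \<open>f\<close> and \<open>h\<close> are almost one at \<open>e\<close>, so a point of the unit ball on which the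
  normalised sum \<open>f + h\<close> is almost one has the same property, and \<open>h\<close> then witnesses the lower
  bound.  In this form the step can be iterated over finitely many vectors \<open>v\<close>.
\<close>

lemma daugavet_subslice:
  fixes f :: "'a::real_normed_vector \<Rightarrow> real"
  assumes D: "daugavet_property (whole_nspace :: 'a nspace)"
    and f: "bounded_linear f" "onorm f = 1" and \<alpha>: "0 < \<alpha>" and \<delta>: "0 < \<delta>"
  obtains g :: "'a \<Rightarrow> real" and \<beta> where "bounded_linear g" "onorm g = 1" "0 < \<beta>"
    "\<And>u. norm u \<le> 1 \<Longrightarrow> 1 - \<beta> < g u \<Longrightarrow> 1 - \<alpha> < f u \<and> norm v + 1 - \<delta> \<le> norm (v + u)"
proof -
  define \<gamma> where "\<gamma> = min (min \<alpha> \<delta>) 1 / 5"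
  have \<gamma>: "0 < \<gamma>" "5 * \<gamma> \<le> \<alpha>" "5 * \<gamma> \<le> \<delta>" "5 * \<gamma> \<le> 1" using \<alpha> \<delta> by (auto simp: \<gamma>_def)
  obtain e where e: "norm e \<le> 1" "1 - \<gamma> < f e" "norm v + 1 - \<gamma> \<le> norm (v + e)"
    using daugavet_slice_element[OF D f \<gamma>(1) \<gamma>(1)] by blast
  obtain h :: "'a \<Rightarrow> real" where h: "linear h" "\<And>x. \<bar>h x\<bar> \<le> norm x" "h (v + e) = norm (v + e)"
    using norming_functional by blast
  have hb: "bounded_linear h"
    using h(1,2) by (intro bounded_linear_intro[of h 1]) (auto simp: linear_add linear_scale)
  have f_le: "\<bar>f x\<bar> \<le> norm x" for x using onorm[OF f(1), of x] f(2) by simp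
  have h_split: "h v + h e = norm (v + e)" using h(1,3) by (simp add: linear_add)
  have he: "1 - \<gamma> \<le> h e" and hv: "norm v - \<gamma> \<le> h v"
    using h_split h(2)[of v] h(2)[of e] e by auto
  define k where "k = (\<lambda>x. f x + h x)"
  have kb: "bounded_linear k" unfolding k_def by (intro bounded_linear_add f(1) hb)
  define N where "N = onorm k"
  have "2 - 2 * \<gamma> \<le> k e" using e(2) he by (simp add: k_def)
  also have "k e \<le> N * norm e" using onorm[OF kb, of e] by (simp add: N_def)
  also have "\<dots> \<le> N"
    using e(1) onorm_pos_le[OF kb] by (simp add: N_def mult_left_le)
  finally have N: "2 - 2 * \<gamma> \<le> N" .
  have N0: "0 < N" using N \<gamma> by simp
  define g where "g = (\<lambda>x. inverse N *\<^sub>R k x)"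
  have g: "bounded_linear g" unfolding g_def by (intro bounded_linear_scaleR_right[THEN bounded_linear_compose] kb)
  moreover have "onorm g = 1"
    unfolding g_def using onorm_scaleR[OF kb, of "inverse N"] N0 by (simp add: N_def)
  moreover have "1 - \<alpha> < f u \<and> norm v + 1 - \<delta> \<le> norm (v + u)"
    if u: "norm u \<le> 1" and gu: "1 - \<gamma> < g u" for u
  proof -
    have "(1 - \<gamma>) * (2 - 2 * \<gamma>) \<le> (1 - \<gamma>) * N" using N \<gamma> by (intro mult_left_mono) auto
    also have "\<dots> < k u" using gu N0 by (simp add: g_def field_simps)
    finally have "2 - 4 * \<gamma> < k u"
      using zero_le_square[of \<gamma>] by (simp add: algebra_simps del: zero_le_square)
    then have "1 - 4 * \<gamma> < f u" "1 - 4 * \<gamma> < h u"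
      using f_le[of u] h(2)[of u] u by (auto simp: k_def)
    moreover have "h v + h u \<le> norm (v + u)"
      using h(2)[of "v + u"] h(1) by (simp add: linear_add)
    ultimately show ?thesis using hv \<gamma> by auto
  qed
  ultimately show thesis using that \<gamma>(1) by blast
qed

lemma daugavet_subslice_finite:
  fixes f :: "'a::real_normed_vector \<Rightarrow> real"
  assumes D: "daugavet_property (whole_nspace :: 'a nspace)"
    and f: "bounded_linear f" "onorm f = 1" and \<alpha>: "0 < \<alpha>" and \<delta>: "0 < \<delta>"
    and F: "finite F"
  shows "\<exists>(g :: 'a \<Rightarrow> real) \<beta>. bounded_linear g \<and> onorm g = 1 \<and> 0 < \<beta> \<and>
    (\<forall>u. norm u \<le> 1 \<and> 1 - \<beta> < g u \<longrightarrow>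
       1 - \<alpha> < f u \<and> (\<forall>v\<in>F. norm v + 1 - \<delta> \<le> norm (v + u)))"
  using F
proof induction
  case empty
  then show ?case using f \<alpha> by (intro exI[of _ f] exI[of _ \<alpha>]) simp
next
  case (insert v F)
  then obtain g :: "'a \<Rightarrow> real" and \<beta> where g: "bounded_linear g" "onorm g = 1" "0 < \<beta>"
    and sub: "\<And>u. norm u \<le> 1 \<Longrightarrow> 1 - \<beta> < g u \<Longrightarrow>
       1 - \<alpha> < f u \<and> (\<forall>v\<in>F. norm v + 1 - \<delta> \<le> norm (v + u))"
    by blast
  obtain g' :: "'a \<Rightarrow> real" and \<beta>' where g': "bounded_linear g'" "onorm g' = 1" "0 < \<beta>'"
    and sub': "\<And>u. norm u \<le> 1 \<Longrightarrow> 1 - \<beta>' < g' u \<Longrightarrow> 1 - \<beta> < g u \<and> norm v + 1 - \<delta> \<le> norm (v + u)"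
    using daugavet_subslice[OF D g \<delta>, of v] by blast
  show ?case
    using g' sub sub' by (intro exI[of _ g'] exI[of _ \<beta>']) auto
qed

lemma daugavet_slice_compact:
  fixes f :: "'a::real_normed_vector \<Rightarrow> real"
  assumes D: "daugavet_property (whole_nspace :: 'a nspace)"
    and f: "bounded_linear f" "onorm f = 1" and \<alpha>: "0 < \<alpha>" and \<delta>: "0 < \<delta>"
    and K: "compact K"
  obtains u where "norm u \<le> 1" "1 - \<alpha> < f u" "\<And>v. v \<in> K \<Longrightarrow> norm v + 1 - \<delta> \<le> norm (v + u)"
proof -
  obtain F where F: "finite F" "K \<subseteq> (\<Union>x\<in>F. ball x (\<delta> / 4))"
    using K \<delta> unfolding compact_eq_totally_bounded by (meson divide_pos_pos zero_less_numeral)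
  have "0 < \<delta> / 2" using \<delta> by simp
  from daugavet_subslice_finite[OF D f \<alpha> this F(1)]
  obtain g :: "'a \<Rightarrow> real" and \<beta> where g: "bounded_linear g" "onorm g = 1" "0 < \<beta>"
    and sub: "\<And>u. norm u \<le> 1 \<Longrightarrow> 1 - \<beta> < g u \<Longrightarrow>
       1 - \<alpha> < f u \<and> (\<forall>v\<in>F. norm v + 1 - \<delta> / 2 \<le> norm (v + u))"
    by blast
  obtain u where u: "norm u \<le> 1" "1 - \<beta> < g u"
    using norm_one_functional_witness[OF g] by blast
  show thesis
  proof (rule that[OF u(1)])
    show "1 - \<alpha> < f u" using sub[OF u] by blast
    fix v assume "v \<in> K"
    then obtain w where w: "w \<in> F" "dist w v < \<delta> / 4" using F(2) by auto
    have "norm w + 1 - \<delta> / 2 \<le> norm (w + u)" using sub[OF u] w(1) by blast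
    moreover have "norm (w + u) \<le> norm (v + u) + dist w v"
      using norm_triangle_ineq[of "v + u" "w - v"] by (simp add: dist_norm algebra_simps)
    moreover have "norm v \<le> norm w + dist w v"
      using norm_triangle_ineq4[of w "w - v"] by (simp add: dist_norm)
    ultimately show "norm v + 1 - \<delta> \<le> norm (v + u)" using w(2) by linarith
  qed
qed

section \<open>Sequences equivalent to the unit vector basis of \<open>\<ell>\<^sup>1\<close>\<close>

lemma compact_bounded_combinations:
  fixes z :: "nat \<Rightarrow> 'a::real_normed_vector"
  shows "compact {(\<Sum>k<n. a k *\<^sub>R z k) |a. \<forall>k<n. \<bar>a k\<bar> \<le> R}"
proof (induction n)
  case 0
  show ?case by simp
next
  case (Suc n)
  let ?K = "\<lambda>n. {(\<Sum>k<n. a k *\<^sub>R z k) |a. \<forall>k<n. \<bar>a k\<bar> \<le> R}"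
  have "?K (Suc n) = (\<lambda>(v, t). v + t *\<^sub>R z n) ` (?K n \<times> {-R..R})"
  proof (intro equalityI subsetI)
    fix x assume "x \<in> ?K (Suc n)"
    then obtain a where a: "x = (\<Sum>k<n. a k *\<^sub>R z k) + a n *\<^sub>R z n" "\<forall>k<Suc n. \<bar>a k\<bar> \<le> R"
      by auto
    show "x \<in> (\<lambda>(v, t). v + t *\<^sub>R z n) ` (?K n \<times> {-R..R})"
      by (rule image_eqI[of _ _ "(\<Sum>k<n. a k *\<^sub>R z k, a n)"])
        (use a in \<open>auto simp: abs_le_iff intro!: exI[of _ a]\<close>)
  next
    fix x assume "x \<in> (\<lambda>(v, t). v + t *\<^sub>R z n) ` (?K n \<times> {-R..R})"
    then obtain a t where x: "x = (\<Sum>k<n. a k *\<^sub>R z k) + t *\<^sub>R z n"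
      and a: "\<forall>k<n. \<bar>a k\<bar> \<le> R" "\<bar>t\<bar> \<le> R"
      by (auto simp: abs_le_iff)
    have "x = (\<Sum>k<Suc n. (a(n := t)) k *\<^sub>R z k)" by (simp add: x)
    moreover have "\<forall>k<Suc n. \<bar>(a(n := t)) k\<bar> \<le> R" using a by (auto simp: less_Suc_eq)
    ultimately show "x \<in> ?K (Suc n)" by blast
  qed
  moreover have "compact ((\<lambda>(v, t). v + t *\<^sub>R z n) ` (?K n \<times> {-R..R}))"
    by (intro compact_continuous_image compact_Times Suc.IH compact_Icc)
      (auto simp: case_prod_unfold intro!: continuous_intros)
  ultimately show ?case by simp
qed

text \<open>
  By homogeneity only the coefficient \<open>b = 1\<close> matters.  Then large combinations of the old vectors
  satisfy the estimate by the triangle inequality alone, thanks to the loss from \<open>c\<close> to \<open>c'\<close>; the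
  remaining ones form a compact set, to which \<open>u\<close> is chosen nearly \<open>\<ell>\<^sup>1\<close>-orthogonal.  There
  \<open>norm (v + w + u)\<close> is almost \<open>norm (v + w) + 1 \<ge> norm v + (1 - norm w)\<close>, whatever the relation
  between \<open>w\<close> and the old vectors is.
\<close>

lemma daugavet_extend_ell1_block:
  fixes f :: "'a::real_normed_vector \<Rightarrow> real" and z :: "nat \<Rightarrow> 'a"
  assumes D: "daugavet_property (whole_nspace :: 'a nspace)"
    and f: "bounded_linear f" "onorm f = 1" and \<alpha>: "0 < \<alpha>"
    and c: "0 \<le> c'" "c' < c" "c' + norm w < 1"
    and z: "\<And>a. c * (\<Sum>k<n. \<bar>a k\<bar>) \<le> norm (\<Sum>k<n. a k *\<^sub>R z k)"
  obtains u where "norm u \<le> 1" "1 - \<alpha> < f u"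
    "\<And>a b. c' * ((\<Sum>k<n. \<bar>a k\<bar>) + \<bar>b\<bar>) \<le> norm ((\<Sum>k<n. a k *\<^sub>R z k) + b *\<^sub>R (u + w))"
proof -
  \<comment> \<open>Beyond this size the triangle inequality suffices, as \<open>norm (u + w) \<le> 1 + norm w\<close>.\<close>
  define R where "R = (c' + 1 + norm w) / (c - c')"
  define K where "K = (\<lambda>v. v + w) ` {(\<Sum>k<n. a k *\<^sub>R z k) |a. \<forall>k<n. \<bar>a k\<bar> \<le> R}"
  have K: "compact K"
    unfolding K_def
    by (intro compact_continuous_image compact_bounded_combinations continuous_intros)
  define \<delta> where "\<delta> = 1 - c' - norm w"
  have \<delta>: "0 < \<delta>" using c by (simp add: \<delta>_def)
  obtain u where u: "norm u \<le> 1" "1 - \<alpha> < f u"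
    and uK: "\<And>v. v \<in> K \<Longrightarrow> norm v + 1 - \<delta> \<le> norm (v + u)"
    using daugavet_slice_compact[OF D f \<alpha> \<delta> K] by blast
  have core: "c' * ((\<Sum>k<n. \<bar>a k\<bar>) + 1) \<le> norm ((\<Sum>k<n. a k *\<^sub>R z k) + (u + w))" for a
  proof -
    define A where "A = (\<Sum>k<n. \<bar>a k\<bar>)"
    define v where "v = (\<Sum>k<n. a k *\<^sub>R z k)"
    have v: "c * A \<le> norm v" using z[of a] by (simp add: A_def v_def)
    have A0: "0 \<le> A" by (simp add: A_def sum_nonneg)
    have "c' * (A + 1) \<le> norm (v + (u + w))"
    proof (cases "A \<le> R")
      case True
      have "\<bar>a k\<bar> \<le> R" if "k < n" for k
        using member_le_sum[of k "{..<n}" "\<lambda>k. \<bar>a k\<bar>"] that True by (simp add: A_def)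
      then have "v + w \<in> K" unfolding K_def v_def by blast
      then have "norm (v + w) + 1 - \<delta> \<le> norm (v + w + u)" by (rule uK)
      moreover have "norm v - norm w \<le> norm (v + w)"
        by (rule norm_diff_ineq)
      moreover have "c' * A \<le> c * A" using c A0 by (intro mult_right_mono) auto
      ultimately show ?thesis using v by (simp add: \<delta>_def algebra_simps)
    next
      case False
      then have "(c' + 1 + norm w) / (c - c') < A" by (simp add: R_def)
      then have "c' + 1 + norm w < (c - c') * A"
        using c by (simp only: pos_divide_less_eq diff_gt_0_iff_gt mult.commute)
      moreover have "norm v - norm (u + w) \<le> norm (v + (u + w))"
        by (rule norm_diff_ineq)
      moreover have "norm (u + w) \<le> 1 + norm w"
        using norm_triangle_ineq[of u w] u(1) by simp
      ultimately show ?thesis using v by (simp add: algebra_simps)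
    qed
    then show ?thesis by (simp add: A_def v_def)
  qed
  show thesis
  proof (rule that[OF u])
    fix a b
    show "c' * ((\<Sum>k<n. \<bar>a k\<bar>) + \<bar>b\<bar>) \<le> norm ((\<Sum>k<n. a k *\<^sub>R z k) + b *\<^sub>R (u + w))"
    proof (cases "b = 0")
      case True
      have "c' * (\<Sum>k<n. \<bar>a k\<bar>) \<le> c * (\<Sum>k<n. \<bar>a k\<bar>)"
        using c by (intro mult_right_mono sum_nonneg) auto
      then show ?thesis using True z[of a] by simp
    next
      case False
      have "(\<Sum>k<n. a k *\<^sub>R z k) + b *\<^sub>R (u + w)
          = b *\<^sub>R ((\<Sum>k<n. (a k / b) *\<^sub>R z k) + (u + w))"
        using False by (simp add: scaleR_add_right scaleR_sum_right)
      moreover have "(\<Sum>k<n. \<bar>a k\<bar>) + \<bar>b\<bar> = \<bar>b\<bar> * ((\<Sum>k<n. \<bar>a k / b\<bar>) + 1)"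
        using False by (simp add: distrib_left sum_distrib_left)
      ultimately show ?thesis
        using mult_left_mono[OF core[of "\<lambda>k. a k / b"], of "\<bar>b\<bar>"]
        by (simp add: mult.assoc mult.left_commute)
    qed
  qed
qed

lemma daugavet_ell1_sequence:
  fixes f :: "'a::real_normed_vector \<Rightarrow> real" and w :: "nat \<Rightarrow> 'a"
  assumes D: "daugavet_property (whole_nspace :: 'a nspace)"
    and f: "bounded_linear f" "onorm f = 1" and \<alpha>: "0 < \<alpha>"
    and w: "\<And>n. norm (w n) \<le> r" and r: "r < 1"
  obtains u :: "nat \<Rightarrow> 'a" and c where "0 < c" "\<And>n. norm (u n) \<le> 1" "\<And>n. 1 - \<alpha> < f (u n)"
    "\<And>n a. c * (\<Sum>k<n. \<bar>a k\<bar>) \<le> norm (\<Sum>k<n. a k *\<^sub>R (u k + w k))"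
proof -
  define c where "c = (1 - r) / 4"
  \<comment> \<open>A strictly decreasing sequence of constants that stays above \<open>c\<close> and starts below \<open>1 - r\<close>.\<close>
  define C where "C = (\<lambda>n::nat. c * (1 + (1 / 2) ^ n))"
  have c: "0 < c" using r by (simp add: c_def)
  have C_dec: "C (Suc n) < C n" for n using c by (simp add: C_def)
  have C_pos: "0 < C n" for n using c by (simp add: C_def add_pos_pos)
  have C_ge: "c \<le> C n" for n using c by (simp add: C_def)
  have C_le: "C n + norm (w m) < 1" for n m
  proof -
    have "C n \<le> c * (1 + 1)" unfolding C_def
      using c by (intro mult_left_mono add_left_mono power_le_one) auto
    then show ?thesis using w[of m] r by (simp add: c_def)
  qed
  define P where "P = (\<lambda>(u :: nat \<Rightarrow> 'a) (n :: nat) x. norm x \<le> 1 \<and> 1 - \<alpha> < f x \<and>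
    (\<forall>a b. C (Suc n) * ((\<Sum>k<n. \<bar>a k\<bar>) + \<bar>b\<bar>)
       \<le> norm ((\<Sum>k<n. a k *\<^sub>R (u k + w k)) + b *\<^sub>R (x + w n))))"
  have "\<exists>u. \<forall>n. P u n (u n)"
  proof (rule dependent_wellorder_choice)
    fix n :: nat and x :: 'a and u u' :: "nat \<Rightarrow> 'a" assume "\<And>m. m < n \<Longrightarrow> u m = u' m"
    then have "(\<Sum>k<n. a k *\<^sub>R (u k + w k)) = (\<Sum>k<n. a k *\<^sub>R (u' k + w k))" for a
      by (intro sum.cong) auto
    then show "P u n x = P u' n x" by (simp add: P_def)
  next
    fix n and u :: "nat \<Rightarrow> 'a" assume IH: "\<And>m. m < n \<Longrightarrow> P u m (u m)"
    have "C n * (\<Sum>k<n. \<bar>a k\<bar>) \<le> norm (\<Sum>k<n. a k *\<^sub>R (u k + w k))" for a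
    proof (cases n)
      case (Suc m)
      then show ?thesis using IH[of m] by (simp add: P_def)
    qed simp
    from daugavet_extend_ell1_block[OF D f \<alpha> less_imp_le[OF C_pos] C_dec C_le this]
    show "\<exists>x. P u n x" unfolding P_def by blast
  qed
  then obtain u where u: "\<And>n. P u n (u n)" by blast
  show thesis
  proof (rule that[OF c])
    show "norm (u n) \<le> 1" "1 - \<alpha> < f (u n)" for n using u[of n] by (simp_all add: P_def)
    fix n a
    show "c * (\<Sum>k<n. \<bar>a k\<bar>) \<le> norm (\<Sum>k<n. a k *\<^sub>R (u k + w k))"
    proof (cases n)
      case (Suc m)
      have "c * (\<Sum>k<n. \<bar>a k\<bar>) \<le> C n * (\<Sum>k<n. \<bar>a k\<bar>)"
        by (intro mult_right_mono C_ge sum_nonneg) auto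
      then show ?thesis using u[of m] Suc by (simp add: P_def) (meson order_trans)
    qed simp
  qed
qed

text \<open>
  The two estimates make \<open>a \<mapsto> (\<Sum>n. a n *\<^sub>R z n)\<close> an isomorphism of \<open>\<ell>\<^sup>1\<close> onto its range.  For
  closedness, preimages of a convergent sequence in the range converge coordinatewise, and the lower
  estimate, applied to partial sums, turns this into convergence in \<open>\<ell>\<^sup>1\<close>.
\<close>

lemma ell1_sequence_spans_closed_ell1:
  fixes z :: "nat \<Rightarrow> 'a::banach"
  assumes M: "\<And>n. norm (z n) \<le> M" and c: "0 < c"
    and lower: "\<And>n a. c * (\<Sum>k<n. \<bar>a k\<bar>) \<le> norm (\<Sum>k<n. a k *\<^sub>R z k)"
  obtains Z where "subspace Z" "closed Z" "isomorphic_nspaces (subspace_nspace Z) ell1_nspace"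
    "range z \<subseteq> Z"
proof -
  define L where "L = {a :: nat \<Rightarrow> real. summable (\<lambda>n. \<bar>a n\<bar>)}"
  define S where "S = (\<lambda>a. \<Sum>n. a n *\<^sub>R z n)"
  have M0: "0 \<le> M" using M[of 0] norm_ge_zero[of "z 0"] by linarith
  have term_le: "norm (a n *\<^sub>R z n) \<le> M * \<bar>a n\<bar>" for a :: "nat \<Rightarrow> real" and n
    using mult_left_mono[OF M[of n], of "\<bar>a n\<bar>"] by (simp add: mult.commute)
  have summ: "summable (\<lambda>n. a n *\<^sub>R z n)" if "a \<in> L" for a
    by (rule summable_comparison_test'[of "\<lambda>n. M * \<bar>a n\<bar>" 0])
      (use that term_le in \<open>auto simp: L_def intro: summable_mult\<close>)
  have upper_S: "norm (S a) \<le> M * (\<Sum>n. \<bar>a n\<bar>)" if "a \<in> L" for a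
  proof -
    have s: "summable (\<lambda>n. M * \<bar>a n\<bar>)" using that by (auto simp: L_def intro: summable_mult)
    have "norm (S a) \<le> (\<Sum>n. M * \<bar>a n\<bar>)"
      unfolding S_def by (rule norm_suminf_le[OF _ s]) (rule term_le)
    also have "\<dots> = M * (\<Sum>n. \<bar>a n\<bar>)" using that by (auto simp: L_def intro: suminf_mult)
    finally show ?thesis .
  qed
  have lower_S: "c * (\<Sum>n. \<bar>a n\<bar>) \<le> norm (S a)" if "a \<in> L" for a
  proof (rule LIMSEQ_le)
    show "(\<lambda>n. c * (\<Sum>k<n. \<bar>a k\<bar>)) \<longlonglongrightarrow> c * (\<Sum>n. \<bar>a n\<bar>)"
      using that by (intro tendsto_mult tendsto_const summable_LIMSEQ) (simp add: L_def)
    show "(\<lambda>n. norm (\<Sum>k<n. a k *\<^sub>R z k)) \<longlonglongrightarrow> norm (S a)"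
      unfolding S_def using summ[OF that] by (intro tendsto_norm summable_LIMSEQ)
    show "\<exists>N. \<forall>n\<ge>N. c * (\<Sum>k<n. \<bar>a k\<bar>) \<le> norm (\<Sum>k<n. a k *\<^sub>R z k)"
      using lower by blast
  qed
  have L_add: "(\<lambda>n. a n + b n) \<in> L" if "a \<in> L" "b \<in> L" for a b
    using that is_normed_space_ell1 by (simp add: is_normed_space_def ell1_nspace_def L_def)
  have L_scale: "(\<lambda>n. t * a n) \<in> L" if "a \<in> L" for t a
    using that is_normed_space_ell1 by (simp add: is_normed_space_def ell1_nspace_def L_def)
  have S_add: "S (\<lambda>n. a n + b n) = S a + S b" if "a \<in> L" "b \<in> L" for a b
    unfolding S_def using summ[OF that(1)] summ[OF that(2)]
    by (simp add: suminf_add scaleR_add_left)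
  have S_scale: "S (\<lambda>n. t * a n) = t *\<^sub>R S a" if "a \<in> L" for t a
    unfolding S_def using summ[OF that] by (simp add: suminf_scaleR_right)
  have L_diff: "(\<lambda>n. a n - b n) \<in> L" if "a \<in> L" "b \<in> L" for a b
    using L_add[OF that(1) L_scale[OF that(2), of "-1"]] by simp
  have S_diff: "S (\<lambda>n. a n - b n) = S a - S b" if "a \<in> L" "b \<in> L" for a b
    using S_add[OF that(1) L_scale[OF that(2), of "-1"]] S_scale[OF that(2), of "-1"] by simp
  have inj: "inj_on S L"
  proof (rule inj_onI)
    fix a b assume ab: "a \<in> L" "b \<in> L" "S a = S b"
    have s: "summable (\<lambda>n. \<bar>a n - b n\<bar>)" using L_diff[OF ab(1,2)] by (simp add: L_def)
    have "c * (\<Sum>n. \<bar>a n - b n\<bar>) \<le> 0"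
      using lower_S[OF L_diff[OF ab(1,2)]] S_diff[OF ab(1,2)] ab(3) by simp
    then have "(\<Sum>n. \<bar>a n - b n\<bar>) \<le> 0" using c by (simp add: mult_le_0_iff)
    then have "(\<Sum>n. \<bar>a n - b n\<bar>) = 0" using suminf_nonneg[OF s] by simp
    then show "a = b" using suminf_eq_zero_iff[OF s] by (simp add: fun_eq_iff)
  qed
  show thesis
  proof (rule that[of "S ` L"])
    have zero: "(\<lambda>n. 0) \<in> L" by (simp add: L_def)
    show sub: "subspace (S ` L)"
    proof (rule subspaceI)
      show "0 \<in> S ` L" using zero by (rule rev_image_eqI) (simp add: S_def)
      show "x + y \<in> S ` L" if "x \<in> S ` L" "y \<in> S ` L" for x y
        using that by (force simp: S_add[symmetric] L_add)
      show "t *\<^sub>R x \<in> S ` L" if "x \<in> S ` L" for t x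
        using that by (force simp: S_scale[symmetric] L_scale)
    qed
    show "range z \<subseteq> S ` L"
    proof clarify
      fix m
      let ?e = "\<lambda>n::nat. if n = m then 1 else 0 :: real"
      have "(\<lambda>n. ?e n *\<^sub>R z n) sums (\<Sum>n\<in>{m}. ?e n *\<^sub>R z n)"
        by (rule sums_finite) auto
      then have "z m = S ?e" by (simp add: S_def sums_iff)
      moreover have "?e \<in> L"
        unfolding L_def mem_Collect_eq by (rule summable_finite[of "{m}"]) auto
      ultimately show "z m \<in> S ` L" by blast
    qed
    show "closed (S ` L)"
      unfolding closed_sequential_limits
    proof (intro allI impI, elim conjE)
      fix X x assume X: "\<forall>n. X n \<in> S ` L" and lim: "X \<longlonglongrightarrow> x"
      have "\<forall>n. \<exists>a. a \<in> L \<and> X n = S a" using X by blast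
      from choice[OF this] obtain A where A: "\<And>n. A n \<in> L" "\<And>n. X n = S (A n)" by blast
      have partial: "(\<Sum>k<N. \<bar>A i k - A j k\<bar>) \<le> norm (X i - X j) / c" for i j N
      proof -
        have s: "summable (\<lambda>n. \<bar>A i n - A j n\<bar>)"
          using L_diff[OF A(1) A(1)] by (simp add: L_def)
        have "(\<Sum>k<N. \<bar>A i k - A j k\<bar>) \<le> (\<Sum>n. \<bar>A i n - A j n\<bar>)"
          by (rule sum_le_suminf[OF s]) auto
        also have "\<dots> \<le> norm (X i - X j) / c"
          using lower_S[OF L_diff[OF A(1) A(1)], of i j] c
          by (simp add: S_diff A pos_le_divide_eq mult.commute)
        finally show ?thesis .
      qed
      have "Cauchy (\<lambda>i. A i k)" for k
      proof (rule metric_CauchyI)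
        fix e :: real assume e: "0 < e"
        have "Cauchy X" using lim by (rule LIMSEQ_imp_Cauchy)
        then obtain N where N: "\<And>i j. N \<le> i \<Longrightarrow> N \<le> j \<Longrightarrow> norm (X i - X j) < e * c"
          using CauchyD[of X "e * c"] e c by auto
        have "\<bar>A i k - A j k\<bar> < e" if ij: "N \<le> i" "N \<le> j" for i j
        proof -
          have "\<bar>A i k - A j k\<bar> \<le> (\<Sum>l<Suc k. \<bar>A i l - A j l\<bar>)" by (simp add: sum_nonneg)
          also have "\<dots> \<le> norm (X i - X j) / c" by (rule partial)
          also have "\<dots> < e" using N[OF ij] c by (simp add: pos_divide_less_eq)
          finally show ?thesis .
        qed
        then show "\<exists>N. \<forall>i\<ge>N. \<forall>j\<ge>N. dist (A i k) (A j k) < e"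
          by (auto simp: dist_real_def)
      qed
      then have "\<forall>k. \<exists>l. (\<lambda>i. A i k) \<longlonglongrightarrow> l"
        by (simp add: Cauchy_convergent_iff convergent_def)
      then obtain b where b: "\<And>k. (\<lambda>i. A i k) \<longlonglongrightarrow> b k" by metis
      \<comment> \<open>Let \<open>j\<close> tend to infinity in the estimate for \<open>A i\<close> and \<open>A j\<close>.\<close>
      have partial_b: "(\<Sum>k<N. \<bar>A i k - b k\<bar>) \<le> norm (X i - x) / c" for i N
      proof (rule LIMSEQ_le)
        show "(\<lambda>j. \<Sum>k<N. \<bar>A i k - A j k\<bar>) \<longlonglongrightarrow> (\<Sum>k<N. \<bar>A i k - b k\<bar>)"
          by (intro tendsto_intros b)
        show "(\<lambda>j. norm (X i - X j) / c) \<longlonglongrightarrow> norm (X i - x) / c"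
          using c by (intro tendsto_intros lim) simp
      qed (use partial in blast)
      have diff: "(\<lambda>k. A i k - b k) \<in> L" for i
        unfolding L_def mem_Collect_eq
        by (rule bounded_imp_summable[of _ "norm (X i - x) / c"])
          (use partial_b[of i "Suc _"] in \<open>auto simp: lessThan_Suc_atMost\<close>)
      have bL: "b \<in> L" using L_diff[OF A(1) diff, of 0 0] by simp
      have "norm (X i - S b) \<le> M * (norm (X i - x) / c)" for i
      proof -
        have "summable (\<lambda>k. \<bar>A i k - b k\<bar>)" using diff[of i] by (simp add: L_def)
        then have "(\<Sum>k. \<bar>A i k - b k\<bar>) \<le> norm (X i - x) / c"
          by (intro suminf_le_const partial_b)
        then have "M * (\<Sum>k. \<bar>A i k - b k\<bar>) \<le> M * (norm (X i - x) / c)"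
          using M0 by (rule mult_left_mono)
        then show ?thesis using upper_S[OF diff[of i]] S_diff[OF A(1) bL, of i] A(2)[of i] by simp
      qed
      moreover have "(\<lambda>i. M * (norm (X i - x) / c)) \<longlonglongrightarrow> M * (norm (x - x) / c)"
        using c by (intro tendsto_intros lim) simp
      ultimately have "(\<lambda>i. X i - S b) \<longlonglongrightarrow> 0"
        by (intro Lim_null_comparison[of "\<lambda>i. X i - S b" "\<lambda>i. M * (norm (X i - x) / c)"]) auto
      then have "X \<longlonglongrightarrow> S b" by (simp add: LIM_zero_iff)
      then have "x = S b" using lim LIMSEQ_unique by blast
      then show "x \<in> S ` L" using bL by blast
    qed
    define T where "T = inv_into L S"
    have T: "T (S a) = a" if "a \<in> L" for a unfolding T_def using inj that by (rule inv_into_f_f)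
    have "bounded_linear_op (subspace_nspace (S ` L)) ell1_nspace T"
      unfolding bounded_linear_op_def linear_op_def
    proof (intro conjI)
      show "\<exists>B. \<forall>x\<in>carr (subspace_nspace (S ` L)).
          nnorm ell1_nspace (T x) \<le> B * nnorm (subspace_nspace (S ` L)) x"
        using lower_S c
        by (intro exI[of _ "inverse c"]) (auto simp: T ell1_nspace_def field_simps)
      show "\<forall>x\<in>carr (subspace_nspace (S ` L)). \<forall>y\<in>carr (subspace_nspace (S ` L)).
          T (nadd (subspace_nspace (S ` L)) x y) = nadd ell1_nspace (T x) (T y)"
      proof (simp add: T ell1_nspace_def, intro ballI)
        fix a b assume "a \<in> L" "b \<in> L"
        then show "T (S a + S b) = (\<lambda>n. a n + b n)"
          using T[OF L_add] by (simp add: S_add)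
      qed
      show "\<forall>t. \<forall>x\<in>carr (subspace_nspace (S ` L)).
          T (nscale (subspace_nspace (S ` L)) t x) = nscale ell1_nspace t (T x)"
      proof (simp add: T ell1_nspace_def, intro allI ballI)
        fix t a assume "a \<in> L"
        then show "T (t *\<^sub>R S a) = (\<lambda>n. t * a n)"
          using T[OF L_scale] by (simp add: S_scale)
      qed
    qed (auto simp: T ell1_nspace_def L_def)
    moreover have "bounded_linear_op ell1_nspace (subspace_nspace (S ` L)) S"
      unfolding bounded_linear_op_def linear_op_def
      using upper_S S_add S_scale by (auto simp: ell1_nspace_def L_def)
    ultimately show "isomorphic_nspaces (subspace_nspace (S ` L)) ell1_nspace"
      unfolding isomorphic_nspaces_def
      by (intro exI[of _ T] exI[of _ S]) (auto simp: T ell1_nspace_def L_def)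
  qed
qed

section \<open>Quotients without the Daugavet property\<close>

lemma functional_le_infdist:
  fixes f :: "'a::real_normed_vector \<Rightarrow> real"
  assumes f: "bounded_linear f" "onorm f = 1" and W: "W \<noteq> {}" "\<And>w. w \<in> W \<Longrightarrow> f w = 0"
  shows "\<bar>f y\<bar> \<le> infdist y W"
  unfolding infdist_notempty[OF W(1)]
proof (rule cINF_greatest[OF W(1)])
  fix w assume "w \<in> W"
  then have "\<bar>f y\<bar> = \<bar>f (y - w)\<bar>"
    using W(2) by (simp add: linear_diff[OF bounded_linear.linear[OF f(1)]])
  also have "\<dots> \<le> dist y w" using onorm[OF f(1), of "y - w"] f(2) by (simp add: dist_norm)
  finally show "\<bar>f y\<bar> \<le> dist y w" .
qed

text \<open>
  The operator \<open>T\<close> that fails the Daugavet equation is \<open>[y] \<mapsto> f y [x]\<close>, whose norm is the norm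
  of \<open>[x]\<close>.  For \<open>\<bar>f y\<bar> \<le> s\<close> the image of \<open>[y]\<close> under \<open>Id + T\<close> is too short since \<open>T [y]\<close> is;
  for \<open>f y > s\<close> it is so by hypothesis, and for \<open>f y < - s\<close> by symmetry.
\<close>

lemma quotient_not_daugavet:
  fixes f :: "'a::real_normed_vector \<Rightarrow> real"
  assumes W: "subspace W"
    and f: "bounded_linear f" "onorm f = 1" "\<And>w. w \<in> W \<Longrightarrow> f w = 0"
    and x: "0 < infdist x W" and s: "s < 1"
    and M: "M < 1 + infdist x W"
    and bound: "\<And>y. infdist y W \<le> 1 \<Longrightarrow> s < f y \<Longrightarrow> infdist (y + f y *\<^sub>R x) W \<le> M"
  shows "\<not> daugavet_property (quotient_nspace W)"
proof
  assume D: "daugavet_property (quotient_nspace W)"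
  let ?Q = "quotient_nspace W"
  define d where "d = infdist x W"
  have d: "0 < d" using x by (simp add: d_def)
  have ne: "W \<noteq> {}" using subspace_0[OF W] by blast
  have lin: "linear f" using f(1) by (rule bounded_linear.linear)
  note Q = quotient_nspace_simps[OF W]
  have f_le: "\<bar>f y\<bar> \<le> infdist y W" for y by (rule functional_le_infdist[OF f(1,2) ne f(3)])
  define T where "T = (\<lambda>A. coset W (f (SOME a. a \<in> A) *\<^sub>R x))"
  have T: "T (coset W y) = coset W (f y *\<^sub>R x)" for y
  proof -
    have "y + 0 \<in> coset W y" unfolding coset_def using subspace_0[OF W] by blast
    then have "(SOME a. a \<in> coset W y) \<in> coset W y" by (rule someI)
    then have "f (SOME a. a \<in> coset W y) = f y"
      using f(3) unfolding coset_def by (auto simp: linear_add[OF lin])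
    then show ?thesis by (simp add: T_def)
  qed
  have norm_T: "nnorm ?Q (T (coset W y)) = \<bar>f y\<bar> * d" for y
    by (simp add: T Q infdist_subspace_scale[OF W] d_def)
  have blo: "bounded_linear_op ?Q ?Q T"
    unfolding bounded_linear_op_def linear_op_def
  proof (intro conjI)
    show "\<exists>B. \<forall>A\<in>carr ?Q. nnorm ?Q (T A) \<le> B * nnorm ?Q A"
    proof (intro exI ballI)
      fix A assume "A \<in> carr ?Q"
      then obtain y where A: "A = coset W y" by (auto simp: Q)
      show "nnorm ?Q (T A) \<le> d * nnorm ?Q A"
        using mult_right_mono[OF f_le[of y], of d] d
        by (simp add: A norm_T) (simp add: Q mult.commute)
    qed
  qed (auto simp: Q T linear_add[OF lin] linear_scale[OF lin] algebra_simps)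
  \<comment> \<open>This \<open>v\<close> witnesses that the norm of \<open>T\<close> exceeds both \<open>M - 1\<close> and \<open>max s 0 * d\<close>.\<close>
  obtain v where v: "norm v \<le> 1" "max s (max 0 ((M - 1) / d)) < f v"
  proof (rule norm_one_functional_witness[OF f(1,2), of "1 - max s (max 0 ((M - 1) / d))"])
    show "0 < 1 - max s (max 0 ((M - 1) / d))"
      using s M d by (simp add: d_def)
  qed (use that in simp)
  have v_M: "M - 1 < f v * d" using v(2) d by (simp add: pos_divide_less_eq)
  have rank: "rank_one_op ?Q ?Q T"
    unfolding rank_one_op_def
  proof (intro bexI[of _ "coset W x"] conjI)
    show "coset W x \<noteq> nzero ?Q"
      using x in_closed_iff_infdist_zero by (auto simp: Q coset_eq_iff[OF W])
    show "T ` carr ?Q = range (\<lambda>c. nscale ?Q c (coset W x))"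
    proof (intro equalityI subsetI)
      fix A assume "A \<in> range (\<lambda>c. nscale ?Q c (coset W x))"
      then obtain c where "A = coset W (c *\<^sub>R x)" by (auto simp: Q)
      then have "A = T (coset W ((c / f v) *\<^sub>R v))"
        using v(2) by (simp add: T linear_scale[OF lin])
      then show "A \<in> T ` carr ?Q" by (simp add: Q)
    qed (auto simp: Q T)
  qed (simp add: Q)
  have T_ge: "f v * d \<le> op_norm ?Q ?Q T"
    unfolding op_norm_def
  proof (rule cSUP_upper2)
    show "bdd_above ((\<lambda>A. nnorm ?Q (T A)) ` {A \<in> carr ?Q. nnorm ?Q A \<le> 1})"
    proof (rule bdd_aboveI2)
      fix A assume "A \<in> {A \<in> carr ?Q. nnorm ?Q A \<le> 1}"
      then obtain y where A: "A = coset W y" "infdist y W \<le> 1" by (auto simp: Q)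
      then have "\<bar>f y\<bar> * d \<le> 1 * d" using f_le[of y] d by (intro mult_right_mono) auto
      then show "nnorm ?Q (T A) \<le> d" by (simp add: A norm_T)
    qed
    have "infdist v W \<le> 1"
      using infdist_le[OF subspace_0[OF W], of v] v(1) by simp
    then show "coset W v \<in> {A \<in> carr ?Q. nnorm ?Q A \<le> 1}" by (simp add: Q)
    show "f v * d \<le> nnorm ?Q (T (coset W v))"
      using d by (simp add: norm_T mult_right_mono)
  qed
  have "op_norm ?Q ?Q (\<lambda>A. nadd ?Q A (T A)) \<le> max M (1 + max s 0 * d)"
    unfolding op_norm_def
  proof (rule cSUP_least)
    have "coset W 0 \<in> {A \<in> carr ?Q. nnorm ?Q A \<le> 1}" using subspace_0[OF W] by (simp add: Q)
    then show "{A \<in> carr ?Q. nnorm ?Q A \<le> 1} \<noteq> {}" by blast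
    fix A assume "A \<in> {A \<in> carr ?Q. nnorm ?Q A \<le> 1}"
    then obtain y where A: "A = coset W y" and y: "infdist y W \<le> 1" by (auto simp: Q)
    have "infdist (y + f y *\<^sub>R x) W \<le> max M (1 + max s 0 * d)"
    proof -
      consider "s < f y" | "s < f (- y)" | "\<bar>f y\<bar> \<le> s" by (simp add: linear_neg[OF lin]) linarith
      then show ?thesis
      proof cases
        case 1
        then show ?thesis using bound[OF y] by simp
      next
        case 2
        have minus: "infdist (- y') W = infdist y' W" for y'
          using infdist_subspace_scale[OF W, of "-1" y'] by simp
        have "infdist (- (y + f y *\<^sub>R x)) W \<le> M"
          using bound[of "- y"] 2 y by (simp add: minus linear_neg[OF lin])
        then show ?thesis by (simp only: minus)
      next
        case 3
        have "infdist (y + f y *\<^sub>R x) W \<le> infdist y W + \<bar>f y\<bar> * d"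
          using infdist_subspace_add[OF W, of y "f y *\<^sub>R x"]
          by (simp add: infdist_subspace_scale[OF W] d_def)
        moreover have "\<bar>f y\<bar> * d \<le> max s 0 * d" using 3 d by (intro mult_right_mono) auto
        ultimately show ?thesis using y by simp
      qed
    qed
    then show "nnorm ?Q (nadd ?Q A (T A)) \<le> max M (1 + max s 0 * d)"
      by (simp add: A T Q)
  qed
  also have "\<dots> < 1 + f v * d" using v_M v(2) d by simp
  also have "\<dots> \<le> 1 + op_norm ?Q ?Q T" using T_ge by simp
  also have "\<dots> = op_norm ?Q ?Q (\<lambda>A. nadd ?Q A (T A))"
    using D blo rank by (simp add: daugavet_property_def)
  finally show False by simp
qed

section \<open>An \<open>\<ell>\<^sup>1\<close>-subspace that is not poor\<close>

lemma dense_sequence_in_open: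
  fixes S :: "'a::metric_space set"
  assumes sep: "separable_space (euclidean :: 'a topology)" and S: "open S" "S \<noteq> {}"
  obtains y :: "nat \<Rightarrow> 'a" where "\<And>n. y n \<in> S" "\<And>x e. x \<in> S \<Longrightarrow> 0 < e \<Longrightarrow> \<exists>n. dist x (y n) < e"
proof -
  obtain C :: "'a set" where C: "countable C" "closure C = UNIV"
    using sep by (auto simp: separable_space_def)
  have near: "\<exists>c\<in>C \<inter> S. dist x c < e" if x: "x \<in> S" and e: "0 < e" for x e
  proof -
    obtain r where r: "0 < r" "ball x r \<subseteq> S" using S(1) x by (meson openE)
    have "x \<in> closure C" using C(2) by simp
    then obtain c where "c \<in> C" "dist c x < min e r"
      using e r(1) unfolding closure_approachable by (metis min_less_iff_conj)
    then show ?thesis using r(2) by (intro bexI[of _ c]) (auto simp: dist_commute)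
  qed
  have ne: "C \<inter> S \<noteq> {}" using S(2) near[of _ 1] by fastforce
  have range: "range (from_nat_into (C \<inter> S)) = C \<inter> S"
    using C(1) ne by (intro range_from_nat_into) auto
  show thesis
  proof (rule that[of "from_nat_into (C \<inter> S)"])
    show "from_nat_into (C \<inter> S) n \<in> S" for n using from_nat_into[OF ne, of n] by blast
    show "\<exists>n. dist x (from_nat_into (C \<inter> S) n) < e" if "x \<in> S" "0 < e" for x e
      using near[OF that] range by (metis (no_types, lifting) imageE)
  qed
qed

theorem theorem3p3:
  assumes "\<exists>x :: 'a::banach. x \<noteq> 0"
    and "separable_space (euclidean :: 'a topology)"
    and "daugavet_property (whole_nspace :: 'a nspace)"
  shows "\<exists>Z :: 'a set. subspace Z \<and> closed Z \<and>
           isomorphic_nspaces (subspace_nspace Z) ell1_nspace \<and> \<not> poor_subspace Z"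
proof -
  obtain x0 :: 'a where "x0 \<noteq> 0" using assms(1) by blast
  obtain f :: "'a \<Rightarrow> real" where lin: "linear f" and f_le: "\<And>x. \<bar>f x\<bar> \<le> norm x"
    and f_x0: "f x0 = norm x0"
    using norming_functional by blast
  have f: "bounded_linear f"
    using lin f_le by (intro bounded_linear_intro[of f 1]) (auto simp: linear_add linear_scale)
  have norm_f: "onorm f = 1"
  proof (rule antisym)
    show "onorm f \<le> 1" using f_le by (intro onorm_bound) auto
    show "1 \<le> onorm f" using onorm[OF f, of x0] f_x0 \<open>x0 \<noteq> 0\<close> by simp
  qed
  \<comment> \<open>Beyond the unit ball, since a coset of norm one need not contain a vector of norm one.\<close>
  define S where "S = {x. norm x < 21/20 \<and> 9/10 < f x}"
  have S_open: "open S"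
    unfolding S_def
    by (intro open_Collect_conj open_Collect_less continuous_intros
          linear_continuous_on[OF f])
  have S_ne: "S \<noteq> {}"
    using norm_one_functional_witness[OF f norm_f, of "1/10"] by (force simp: S_def)
  obtain y :: "nat \<Rightarrow> 'a" where yS: "\<And>n. y n \<in> S"
    and dense: "\<And>x e. x \<in> S \<Longrightarrow> 0 < e \<Longrightarrow> \<exists>n. dist x (y n) < e"
    by (rule dense_sequence_in_open[OF assms(2) S_open S_ne]) blast
  have y: "norm (y n) < 21/20" "9/10 < f (y n)" for n using yS[of n] by (auto simp: S_def)
  define w where "w = (\<lambda>n. (1/2) *\<^sub>R y n)"
  have w: "norm (w n) \<le> 21/40" for n using y(1)[of n] by (simp add: w_def)
  obtain u :: "nat \<Rightarrow> 'a" and c where c: "0 < c" and u: "\<And>n. norm (u n) \<le> 1" "\<And>n. 1 - 1/10 < f (u n)"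
    and lower: "\<And>n a. c * (\<Sum>k<n. \<bar>a k\<bar>) \<le> norm (\<Sum>k<n. a k *\<^sub>R (u k + w k))"
    by (rule daugavet_ell1_sequence[OF assms(3) f norm_f, of "1/10" w "21/40"]) (rule w | blast | simp)+
  define z where "z = (\<lambda>n. u n + w n)"
  have norm_z: "norm (z n) \<le> 61/40" for n
    using norm_triangle_ineq[of "u n" "w n"] u(1)[of n] w[of n] by (simp add: z_def)
  have fz: "27/20 < f (z n)" "f (z n) \<le> 61/40" for n
    using u(2)[of n] y(2)[of n] f_le[of "z n"] norm_z[of n]
    by (auto simp: z_def w_def linear_add[OF lin] linear_scale[OF lin])
  have lower_z: "c * (\<Sum>k<n. \<bar>a k\<bar>) \<le> norm (\<Sum>k<n. a k *\<^sub>R z k)" for n a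
    using lower by (simp add: z_def)
  obtain Z where Z: "subspace Z" "closed Z" "isomorphic_nspaces (subspace_nspace Z) ell1_nspace"
    "range z \<subseteq> Z"
    by (rule ell1_sequence_spans_closed_ell1[OF norm_z c lower_z])
  define W where "W = {v \<in> Z. f v = 0}"
  have W: "subspace W"
    using Z(1) unfolding W_def subspace_def
    by (auto simp: linear_0[OF lin] linear_add[OF lin] linear_scale[OF lin])
  have "closed {v. f v = 0}"
    by (intro closed_Collect_eq continuous_intros linear_continuous_on[OF f])
  then have W_closed: "closed W"
    using Z(2) by (simp add: W_def Collect_conj_eq closed_Int)
  have fW: "f v = 0" if "v \<in> W" for v using that by (simp add: W_def)
  define x where "x = (-(2/3)) *\<^sub>R z 0"
  have norm_x: "norm x \<le> 61/60" using norm_z[of 0] by (simp add: x_def)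
  have "\<bar>f x\<bar> \<le> infdist x W"
    using W subspace_0 by (intro functional_le_infdist[OF f norm_f _ fW]) auto
  then have dx: "9/10 \<le> infdist x W"
    using fz(1)[of 0] by (simp add: x_def linear_scale[OF lin] linear_neg[OF lin])
  have key: "infdist (y n + x) W \<le> 36/25" for n
  proof -
    \<comment> \<open>The coefficient for which \<open>f\<close> vanishes at \<open>x + l *\<^sub>R z n\<close>.\<close>
    define l where "l = (2/3) * f (z 0) / f (z n)"
    have l: "0 \<le> l" "l \<le> 4/5"
      using fz[of 0] fz[of n] by (auto simp: l_def pos_divide_le_eq)
    have in_W: "x + l *\<^sub>R z n \<in> W"
    proof -
      have "f (x + l *\<^sub>R z n) = 0"
        using fz(1)[of n] by (simp add: x_def l_def linear_diff[OF lin] linear_scale[OF lin])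
      moreover have "x + l *\<^sub>R z n \<in> Z"
        unfolding x_def using Z(1,4) by (intro subspace_add subspace_scale) auto
      ultimately show ?thesis by (simp add: W_def)
    qed
    have eq: "y n + x - (x + l *\<^sub>R z n) = (1 - l/2) *\<^sub>R y n - l *\<^sub>R u n"
      by (simp add: z_def w_def algebra_simps)
    have "infdist (y n + x) W \<le> norm ((1 - l/2) *\<^sub>R y n - l *\<^sub>R u n)"
      using infdist_le[OF in_W, of "y n + x"] by (simp only: dist_norm eq)
    also have "\<dots> \<le> (1 - l/2) * norm (y n) + l * norm (u n)"
      using norm_triangle_ineq4[of "(1 - l/2) *\<^sub>R y n" "l *\<^sub>R u n"] l by simp
    also have "\<dots> \<le> (1 - l/2) * (21/20) + l * 1"
      using l y(1)[of n] u(1)[of n] by (intro add_mono mult_left_mono) auto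
    also have "\<dots> \<le> 36/25" using l(2) by (simp add: field_simps)
    finally show ?thesis .
  qed
  have "\<not> daugavet_property (quotient_nspace W)"
  proof (rule quotient_not_daugavet[OF W f norm_f fW])
    show "0 < infdist x W" using dx by simp
    show "9/10 < (1::real)" by simp
    show "(9/5 :: real) < 1 + infdist x W" using dx by simp
    fix v assume v: "infdist v W \<le> 1" "9/10 < f v"
    have ne: "W \<noteq> {}" using subspace_0[OF W] by blast
    obtain b where b: "b \<in> W" "norm (v - b) < 21/20"
    proof -
      have "(INF b\<in>W. dist v b) < 21/20" using v(1) by (simp add: infdist_notempty[OF ne, symmetric])
      then obtain b where "b \<in> W" "dist v b < 21/20"
        using cINF_less_iff[OF ne, of "dist v" "21/20"] bdd_belowI2[of W 0 "dist v"] by auto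
      then show thesis using that by (simp add: dist_norm)
    qed
    have "v - b \<in> S" using b v(2) fW[OF b(1)] by (simp add: S_def linear_diff[OF lin])
    then obtain n where n: "norm (v - b - y n) < 1/20"
      using dense[of "v - b" "1/20"] by (auto simp: dist_norm)
    have "f v \<le> 21/20"
      using f_le[of "v - b"] b fW[OF b(1)] by (simp add: linear_diff[OF lin])
    then have fv: "\<bar>f v - 1\<bar> \<le> 1/10"
      using v(2) by linarith
    \<comment> \<open>Up to \<open>b \<in> W\<close> and an error below \<open>1/5\<close>, this is \<open>y n + x\<close>.\<close>
    have eq: "v + f v *\<^sub>R x = b + ((y n + x) + ((v - b - y n) + (f v - 1) *\<^sub>R x))"
      by (simp add: algebra_simps)
    have "infdist (v + f v *\<^sub>R x) W \<le> infdist b W + infdist ((y n + x) + ((v - b - y n) + (f v - 1) *\<^sub>R x)) W"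
      unfolding eq by (rule infdist_subspace_add[OF W])
    moreover have "infdist b W = 0" using b(1) by simp
    moreover have "infdist ((v - b - y n) + (f v - 1) *\<^sub>R x) W \<le> 1/20 + 1/10 * (61/60)"
    proof -
      have "infdist ((v - b - y n) + (f v - 1) *\<^sub>R x) W \<le> norm ((v - b - y n) + (f v - 1) *\<^sub>R x)"
        using infdist_le[OF subspace_0[OF W], of "(v - b - y n) + (f v - 1) *\<^sub>R x"] by simp
      also have "\<dots> \<le> norm (v - b - y n) + \<bar>f v - 1\<bar> * norm x"
        using norm_triangle_ineq[of "v - b - y n" "(f v - 1) *\<^sub>R x"] by simp
      also have "\<dots> \<le> 1/20 + 1/10 * (61/60)"
        using n fv norm_x by (intro add_mono mult_mono) auto
      finally show ?thesis .
    qed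
    ultimately show "infdist (v + f v *\<^sub>R x) W \<le> 9/5"
      using infdist_subspace_add[OF W, of "y n + x" "(v - b - y n) + (f v - 1) *\<^sub>R x"] key[of n]
      by linarith
  qed
  moreover have "W \<subseteq> Z" by (auto simp: W_def)
  ultimately have "\<not> poor_subspace Z"
    using W W_closed by (auto simp: poor_subspace_def)
  then show ?thesis using Z by blast
qed

end
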